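(* Let $f:\mathbb{R}^d\to\mathbb{R}\cup\{\infty\}$ be convex and $\ell$-smooth, attaining its minimum at $x^*\in\mathbb{R}^d$, and let $x^0\in\mathcal{X}$, $x^0\ne x^*$, $R:=\|x^0-x^*\|$. Suppose that $\psi:\mathbb{R}_+\to\mathbb{R}_+$, $\psi(x)=\frac{x^2}{2\ell(4x)}$, is strictly increasing and $\lim_{x\to\infty}\psi(x)=\infty$. Let $\Gamma_0>0$ satisfy $\Gamma_0\ge\frac{2(f(x^0)-f(x^* ))}{\|x^0-x^*\|^2}$, let $\bar R\ge R$, and let $\varepsilon>0$. Then the oracle complexity (number of gradient calls) required by Algorithm 2 with parameters $\Gamma_0,\bar R$ to find an $\varepsilon$-solution is at most (rounded up to an integer) $$\frac{5\sqrt{\ell(0)}\,R}{\sqrt{\varepsilon}}+\max\left\{2+\log_{3/2}\left(\frac{\Gamma_0}{4\ell(0)}\right),0\right\}+k_{\mathrm{init}},$$ where $k_{\mathrm{init}}$ is the smallest positive integer such that $$\ell\left(24\sqrt{\frac{\ell\left(4\psi^{-1}(\Gamma_0\bar R^2)\right)\ell(0)\,\bar R^2}{k_{\mathrm{init}}^2}}\right)\le 2\ell(0).$$ (The last two terms of the bound do not depend on $\varepsilon$.)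
   Context: $\|\cdot\|$ is the Euclidean norm for vectors and the spectral norm for matrices; $\mathbb{R}_+=[0,\infty)$. An $\varepsilon$-solution is a point $\bar x\in\mathbb{R}^d$ with $f(\bar x)-\inf_{x} f(x)\le\varepsilon$. Setting: $f:\mathbb{R}^d\to\mathbb{R}\cup\{\infty\}$, $\mathcal{X}:=\{x\in\mathbb{R}^d: f(x)<\infty\}$ is assumed to be an open, $d$-dimensional (nonempty) convex set, and $\bar{\mathcal{X}}$ denotes its closure; $\mathrm{Proj}_{\bar{\mathcal{X}}}$ is the Euclidean projection onto $\bar{\mathcal{X}}$. $f$ is $\ell$-smooth if $f$ is twice differentiable on $\mathcal{X}$, continuous on $\bar{\mathcal{X}}$, and $\ell:[0,\infty)\to(0,\infty)$ is a non-decreasing, positive, locally Lipschitz function with $\|\nabla^2 f(x)\|\le \ell(\|\nabla f(x)\|)$ for all $x\in\mathcal{X}$. Algorithm 2 (input: $x^0\in\mathcal{X}$, $\ell$, $\Gamma_0$, $\bar R$; $\psi^{-1}$ is the inverse of $\psi$ on $\mathbb{R}_+$). Set $y^0=u^0=x^0$ and for $k=0,1,2,\dots$: $\gamma_k=1/\ell\left(4\psi^{-1}(\Gamma_k\bar R^2)\right)$; $\alpha_k=\sqrt{\gamma_k\Gamma_k}$; $y^{k+1}=\frac{1}{1+\alpha_k}y^k+\frac{\alpha_k}{1+\alpha_k}u^k-\frac{\gamma_k}{1+\alpha_k}\nabla f(y^k)$; $u^{k+1}=\mathrm{Proj}_{\bar{\mathcal{X}}}\left(u^k-\frac{\alpha_k}{\Gamma_k}\nabla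 f(y^{k+1})\right)$; $\Gamma_{k+1}=\Gamma_k/(1+\alpha_k)$. One new gradient is computed per iteration. *)

theory Defs
  imports "HOL-Analysis.Analysis"
begin

definition edom :: "('a \<Rightarrow> ereal) \<Rightarrow> 'a set" where
  "edom f = {x. f x < \<infinity>}"

text \<open>Jensen's inequality in \<^typ>\<open>ereal\<close>; the convention \<open>0 * \<infinity> = 0\<close> makes the cases
  \<open>t = 0\<close> and \<open>t = 1\<close> trivially true.\<close>

definition convex_ereal_fun :: "('a::real_vector \<Rightarrow> ereal) \<Rightarrow> bool" where
  "convex_ereal_fun f \<longleftrightarrow>
     (\<forall>x y. \<forall>t\<in>{0..1}. f ((1 - t) *\<^sub>R x + t *\<^sub>R y) \<le> ereal (1 - t) * f x + ereal t * f y)"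

text \<open>The finite part of \<open>f\<close>. Derivatives of it are only taken at points of the open set \<open>edom f\<close>,
  so its values elsewhere play no role.\<close>

definition fin_part :: "('a \<Rightarrow> ereal) \<Rightarrow> 'a \<Rightarrow> real" where
  "fin_part f x = real_of_ereal (f x)"

definition gradient :: "('a::real_inner \<Rightarrow> ereal) \<Rightarrow> 'a \<Rightarrow> 'a" where
  "gradient f x = (THE D. GDERIV (fin_part f) x :> D)"

definition hessian :: "(real^'d \<Rightarrow> ereal) \<Rightarrow> real^'d \<Rightarrow> real^'d^'d" where
  "hessian f x = jacobian (gradient f) (at x)"

definition spectral_norm :: "real^'n^'m \<Rightarrow> real" where
  "spectral_norm A = onorm (\<lambda>v. A *v v)"

text \<open>The function \<open>ell\<close> lives on \<open>[0,\<infinity>)\<close>; its values at negative arguments are irrelevant.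
  The first argument of \<^const>\<open>local_lipschitz\<close> is a parameter on which \<open>ell\<close> does not depend.
  Continuity of \<open>f\<close> on the closure of its domain is with respect to the topology of
  \<^typ>\<open>ereal\<close>: when the domain is open, \<open>f\<close> equals \<open>\<infinity>\<close> on its boundary and must tend
  to \<open>\<infinity>\<close> there.\<close>

definition ell_smooth :: "(real \<Rightarrow> real) \<Rightarrow> (real^'d \<Rightarrow> ereal) \<Rightarrow> bool" where
  "ell_smooth ell f \<longleftrightarrow>
     mono_on {0..} ell \<and> (\<forall>s\<ge>0. ell s > 0) \<and> local_lipschitz (UNIV :: real set) {0..} (\<lambda>_. ell) \<and>
     (\<forall>x\<in>edom f. fin_part f differentiable (at x)) \<and>
     (\<forall>x\<in>edom f. gradient f differentiable (at x)) \<and>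
     continuous_on (closure (edom f)) f \<and>
     (\<forall>x\<in>edom f. spectral_norm (hessian f x) \<le> ell (norm (gradient f x)))"

definition eps_solution :: "('a \<Rightarrow> ereal) \<Rightarrow> real \<Rightarrow> 'a \<Rightarrow> bool" where
  "eps_solution f \<epsilon> x \<longleftrightarrow> f x - (INF z. f z) \<le> ereal \<epsilon>"

definition psi :: "(real \<Rightarrow> real) \<Rightarrow> real \<Rightarrow> real" where
  "psi ell x = x\<^sup>2 / (2 * ell (4 * x))"

definition psi_inv :: "(real \<Rightarrow> real) \<Rightarrow> real \<Rightarrow> real" where
  "psi_inv ell = inv_into {0..} (psi ell)"

definition step_gamma :: "(real \<Rightarrow> real) \<Rightarrow> real \<Rightarrow> real \<Rightarrow> real" where
  "step_gamma ell Rbar \<Gamma> = 1 / ell (4 * psi_inv ell (\<Gamma> * Rbar\<^sup>2))"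

definition step_alpha :: "(real \<Rightarrow> real) \<Rightarrow> real \<Rightarrow> real \<Rightarrow> real" where
  "step_alpha ell Rbar \<Gamma> = sqrt (step_gamma ell Rbar \<Gamma> * \<Gamma>)"

primrec agd_Gamma :: "(real \<Rightarrow> real) \<Rightarrow> real \<Rightarrow> real \<Rightarrow> nat \<Rightarrow> real" where
  "agd_Gamma ell \<Gamma>0 Rbar 0 = \<Gamma>0"
| "agd_Gamma ell \<Gamma>0 Rbar (Suc k) =
     agd_Gamma ell \<Gamma>0 Rbar k / (1 + step_alpha ell Rbar (agd_Gamma ell \<Gamma>0 Rbar k))"

text \<open>The pair \<open>(y\<^sup>k, u\<^sup>k)\<close>.\<close>

primrec agd ::
  "('a::euclidean_space \<Rightarrow> ereal) \<Rightarrow> (real \<Rightarrow> real) \<Rightarrow> real \<Rightarrow> real \<Rightarrow> 'a \<Rightarrow> nat \<Rightarrow> 'a \<times> 'a" where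
  "agd f ell \<Gamma>0 Rbar x0 0 = (x0, x0)"
| "agd f ell \<Gamma>0 Rbar x0 (Suc k) =
     (let (y, u) = agd f ell \<Gamma>0 Rbar x0 k;
          \<Gamma> = agd_Gamma ell \<Gamma>0 Rbar k;
          \<gamma> = step_gamma ell Rbar \<Gamma>;
          \<alpha> = step_alpha ell Rbar \<Gamma>;
          y' = (1 / (1 + \<alpha>)) *\<^sub>R y + (\<alpha> / (1 + \<alpha>)) *\<^sub>R u - (\<gamma> / (1 + \<alpha>)) *\<^sub>R gradient f y;
          u' = closest_point (closure (edom f)) (u - (\<alpha> / \<Gamma>) *\<^sub>R gradient f y')
      in (y', u'))"

definition agd_y ::
  "('a::euclidean_space \<Rightarrow> ereal) \<Rightarrow> (real \<Rightarrow> real) \<Rightarrow> real \<Rightarrow> real \<Rightarrow> 'a \<Rightarrow> nat \<Rightarrow> 'a" where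
  "agd_y f ell \<Gamma>0 Rbar x0 k = fst (agd f ell \<Gamma>0 Rbar x0 k)"

text \<open>Computing \<open>y\<^sup>N\<close> takes exactly \<open>N\<close> gradient calls, namely at the points
  \<open>y\<^sup>k\<close> with \<open>k < N\<close> (the point \<open>u\<close> entering \<open>y\<^sup>N\<close> reuses the last of these). The calls must be
  legitimate, i.e. made inside the domain, where the gradient exists. The complexity is the number
  of calls after which the first \<open>\<epsilon>\<close>-solution is found, and \<open>\<infinity>\<close> if none is ever found.\<close>

definition agd_oracle_complexity ::
  "('a::euclidean_space \<Rightarrow> ereal) \<Rightarrow> (real \<Rightarrow> real) \<Rightarrow> real \<Rightarrow> real \<Rightarrow> 'a \<Rightarrow> real \<Rightarrow> enat" where
  "agd_oracle_complexity f ell \<Gamma>0 Rbar x0 \<epsilon> =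
     Inf {enat N | N. (\<forall>k<N. agd_y f ell \<Gamma>0 Rbar x0 k \<in> edom f) \<and>
                      eps_solution f \<epsilon> (agd_y f ell \<Gamma>0 Rbar x0 N)}"

definition k_init :: "(real \<Rightarrow> real) \<Rightarrow> real \<Rightarrow> real \<Rightarrow> nat" where
  "k_init ell \<Gamma>0 Rbar =
     (LEAST k. 0 < k \<and>
        ell (24 * sqrt (ell (4 * psi_inv ell (\<Gamma>0 * Rbar\<^sup>2)) * ell 0 * Rbar\<^sup>2 / (real k)\<^sup>2)) \<le> 2 * ell 0)"

end

theory Submission
  imports Defs
begin

text \<open>The quantity \<open>V\<^sub>k = f(y\<^sup>k) - f(x\<^sup>*) + \<Gamma>\<^sub>k/2 \<parallel>u\<^sup>k - x\<^sup>*\<parallel>\<^sup>2\<close> satisfies \<open>(1 + \<alpha>\<^sub>k) V\<^sub>k\<^sub>+\<^sub>1 \<le> V\<^sub>k\<close>, so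
  \<open>f(y\<^sup>k) - f(x\<^sup>*) \<le> \<Gamma>\<^sub>k R\<^sup>2\<close>. The decrease rests on the co-coercivity inequality
  \<open>f(y) \<ge> f(x) + \<nabla>f(x) \<bullet> (y - x) + \<parallel>\<nabla>f(x) - \<nabla>f(y)\<parallel>\<^sup>2 / (2 L)\<close>, where
  \<open>L = \<ell>(\<parallel>\<nabla>f(y)\<parallel> + \<parallel>\<nabla>f(x) - \<nabla>f(y)\<parallel>)\<close>. With the minimizer as \<open>x\<close> it gives
  \<open>\<psi>(\<parallel>\<nabla>f(y)\<parallel>) \<le> f(y) - f(x\<^sup>*)\<close>, so that \<open>\<psi>\<^sup>-\<^sup>1(\<Gamma>\<^sub>k R\<^sup>2)\<close> bounds the gradient at \<open>y\<^sup>k\<close>; a continuation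
  argument in the step length transfers the bound to \<open>y\<^sup>k\<^sup>+\<^sup>1\<close> and keeps it inside the domain.

  For the rate, each step with \<open>\<alpha>\<^sub>k \<le> 3\<close> increases \<open>1/\<surd>\<Gamma>\<^sub>k\<close> by at least \<open>\<surd>\<gamma>\<^sub>k / 3\<close>, while the steps with
  \<open>\<alpha>\<^sub>k > 3\<close> shrink \<open>\<Gamma>\<^sub>k\<close> geometrically and only occur when \<open>\<Gamma>\<^sub>k > 9 \<ell>(0)\<close>; they account for the logarithm.
  After \<open>k\<^sub>i\<^sub>n\<^sub>i\<^sub>t\<close> steps of the first kind \<open>\<Gamma>\<^sub>k\<close> is so small that \<open>\<gamma>\<^sub>k \<ge> 1/(2 \<ell>(0))\<close>, and
  \<open>5 \<surd>\<ell>(0) R / \<surd>\<epsilon>\<close> further ones suffice since \<open>3 \<surd>2 \<le> 5\<close>.\<close>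

section \<open>Convex functions with gradient-dependent smoothness\<close>

text \<open>Continuous induction: at the infimum of the failing points \<open>P\<close> holds by
  \<open>base\<close> or \<open>lim\<close>, and \<open>step\<close> then pushes that infimum
  further right. It drives both arguments in which a step length grows from 0.\<close>

lemma real_interval_induct:
  fixes a b :: real
  assumes base: "P a"
    and step: "\<And>s. \<lbrakk>a \<le> s; s < b; \<forall>t\<in>{a..s}. P t\<rbrakk> \<Longrightarrow> eventually P (at_right s)"
    and lim: "\<And>s. \<lbrakk>a < s; s \<le> b; \<forall>t\<in>{a..<s}. P t\<rbrakk> \<Longrightarrow> P s"
    and t: "t \<in> {a..b}"
  shows "P t"
proof (rule ccontr)
  assume "\<not> P t"
  define N where "N = {s\<in>{a..b}. \<not> P s}"
  define i where "i = Inf N"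
  have tN: "t \<in> N" and N: "N \<noteq> {}" "bdd_below N"
    using t \<open>\<not> P t\<close> by (auto simp: N_def intro!: bdd_belowI[of _ a])
  have ia: "a \<le> i" unfolding i_def by (rule cInf_greatest[OF N(1)]) (auto simp: N_def)
  have it: "i \<le> t" unfolding i_def by (rule cInf_lower[OF tN N(2)])
  have below: "P s" if "a \<le> s" "s < i" for s
    using cInf_lower[OF _ N(2), of s] that it t by (auto simp: N_def i_def)
  have Pi: "P i"
    using base lim[of i] below ia it t by (cases "i = a") auto
  have "i < b"
    using cInf_lower[OF tN N(2)] Pi it t \<open>\<not> P t\<close> by (cases "t = i") (auto simp: i_def)
  moreover have "\<forall>s\<in>{a..i}. P s" using below Pi by (auto simp: order_le_less)
  ultimately obtain c where c: "c > i" "\<forall>y>i. y < c \<longrightarrow> P y"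
    using step[OF ia] by (auto simp: eventually_at_right_field)
  have "c \<le> i" unfolding i_def
  proof (rule cInf_greatest[OF N(1)])
    fix s assume s: "s \<in> N"
    then have "i \<le> s" using cInf_lower[OF s N(2)] by (simp add: i_def)
    moreover have "\<not> P s" using s by (simp add: N_def)
    ultimately show "c \<le> s" using c Pi by (metis not_le order_le_less)
  qed
  with c show False by simp
qed

text \<open>\<open>closed_sublevel\<close> means closed in the whole space, not relative to
  \<open>X\<close>. So a limit of points of \<open>X\<close> with bounded values of \<open>F\<close>
  stays in \<open>X\<close>: this is how continuity of the extended-valued function on the closure
  of its domain enters.\<close>

locale gen_smooth =
  fixes X :: "'a::euclidean_space set" and F :: "'a \<Rightarrow> real" and G :: "'a \<Rightarrow> 'a"
    and H :: "'a \<Rightarrow> 'a \<Rightarrow> 'a" and ell :: "real \<Rightarrow> real"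
  assumes open_X: "open X" and convex_F: "convex_on X F"
    and closed_sublevel: "\<And>C. closed {x\<in>X. F x \<le> C}"
    and F_deriv: "\<And>x. x \<in> X \<Longrightarrow> GDERIV F x :> G x"
    and G_deriv: "\<And>x. x \<in> X \<Longrightarrow> (G has_derivative H x) (at x)"
    and H_bound: "\<And>x. x \<in> X \<Longrightarrow> onorm (H x) \<le> ell (norm (G x))"
    and ell_mono: "mono_on {0..} ell" and ell_pos: "\<And>s. 0 \<le> s \<Longrightarrow> 0 < ell s"
begin

section \<open>First-order inequalities from convexity and gradient-dependent smoothness\<close>

lemma convex_X: "convex X"
  using convex_F by (simp add: convex_on_def)

lemma continuous_G: "x \<in> X \<Longrightarrow> isCont G x"
  using G_deriv has_derivative_continuous by blast

lemma F_along_line: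
  assumes "x + t *\<^sub>R v \<in> X"
  shows "((\<lambda>t. F (x + t *\<^sub>R v)) has_real_derivative v \<bullet> G (x + t *\<^sub>R v)) (at t within S)"
proof -
  have "((\<lambda>t. x + t *\<^sub>R v) has_derivative (\<lambda>t. t *\<^sub>R v)) (at t within S)"
    by (auto intro!: derivative_eq_intros)
  from has_derivative_compose[OF this F_deriv[OF assms, unfolded gderiv_def]]
  show ?thesis
    by (simp add: has_field_derivative_def mult_commute_abs)
qed

lemma gradient_ineq:
  assumes x: "x \<in> X" and y: "y \<in> X"
  shows "F x + G x \<bullet> (y - x) \<le> F y"
proof -
  define p where "p = (\<lambda>t::real. x + t *\<^sub>R (y - x))"
  \<comment> \<open>An open interval containing 0 and 1; the one-dimensional tangent inequality is
    applied there at 0.\<close>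
  define A where "A = p -` X"
  have comb: "p ((1 - u) *\<^sub>R s + u *\<^sub>R t) = (1 - u) *\<^sub>R p s + u *\<^sub>R p t" for u s t
    by (simp add: p_def algebra_simps)
  note comb' = comb[unfolded real_scaleR_def]
  have "open A"
    unfolding A_def p_def by (intro open_vimage open_X continuous_intros)
  have "convex A"
    unfolding convex_alt A_def using convexD_alt[OF convex_X] comb by auto
  moreover from this have "convex_on A (\<lambda>t. F (p t))"
    using convex_onD[OF convex_F] by (intro convex_onI) (auto simp: A_def comb')
  moreover have A01: "0 \<in> A" "1 \<in> A" using x y by (auto simp: A_def p_def)
  moreover have "((\<lambda>t. F (p t)) has_real_derivative (y - x) \<bullet> G x) (at 0 within A)"
    using F_along_line[of x 0 "y - x"] x by (simp add: p_def)
  ultimately have "F (p 1) - F (p 0) \<ge> ((y - x) \<bullet> G x) * (1 - 0)"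
    using \<open>open A\<close> by (intro convex_on_imp_above_tangent) (auto simp: convex_connected interior_open)
  then show ?thesis by (simp add: p_def inner_commute)
qed

lemma G_lipschitz_on_segment:
  assumes "\<And>z. z \<in> closed_segment a b \<Longrightarrow> z \<in> X \<and> norm (G z) \<le> r"
  shows "norm (G b - G a) \<le> ell r * norm (b - a)"
proof -
  have "norm (G a) \<le> r" using assms[of a] by simp
  then have "0 \<le> r" using norm_ge_zero order_trans by blast
  show ?thesis
  proof (rule differentiable_bound[of "closed_segment a b" G H])
    fix z assume z: "z \<in> closed_segment a b"
    show "(G has_derivative H z) (at z within closed_segment a b)"
      using G_deriv assms z has_derivative_at_withinI by blast
    have "ell (norm (G z)) \<le> ell r"
      using ell_mono assms[OF z] \<open>0 \<le> r\<close> by (auto intro: mono_onD)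
    then show "onorm (H z) \<le> ell r"
      using H_bound[of z] assms[OF z] by simp
  qed auto
qed

text \<open>A gradient step for \<open>F - G x \<bullet> _\<close>, which is minimal at
  \<open>x\<close>, goes from \<open>y\<close> along \<open>- d\<close> with
  \<open>d = G y - G x\<close>. Its descent estimate at length \<open>1 / L\<close> gives the
  quadratic term. What needs work is that the path stays in \<open>X\<close> and that
  \<open>L\<close> is a Lipschitz constant of \<open>G\<close> along it.\<close>

lemma co_coercive:
  assumes x: "x \<in> X" and y: "y \<in> X"
  shows "F x + G x \<bullet> (y - x) + (norm (G x - G y))\<^sup>2 / (2 * ell (norm (G y) + norm (G x - G y)))
           \<le> F y"
proof (cases "G x = G y")
  case True
  then show ?thesis using gradient_ineq[OF x y] by simp
next
  case False
  define h where "h = G y"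
  define d where "d = h - G x"
  define D where "D = norm d"
  define L where "L = ell (norm h + D)"
  define z where "z = (\<lambda>t::real. y + t *\<^sub>R (- d))"
  have D: "D > 0" using False by (simp add: D_def d_def h_def)
  have L: "L > 0" unfolding L_def by (rule ell_pos) (use D in simp)
  have z0: "z 0 = y" by (simp add: z_def)
  have zdiff: "z t - z s = (s - t) *\<^sub>R d" for s t by (simp add: z_def algebra_simps)
  have zcont: "isCont z t" for t unfolding z_def by (intro continuous_intros)
  \<comment> \<open>The second conjunct bounds the gradient norm by \<open>norm h + D\<close>, the
    argument of \<open>ell\<close> in \<open>L\<close>.\<close>
  define P where "P = (\<lambda>t. z t \<in> X \<and> norm (G (z t) - h) \<le> D)"
  have seg: "\<exists>s\<in>{0..t}. w = z s" if "0 \<le> t" and w: "w \<in> closed_segment (z 0) (z t)" for w t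
  proof -
    obtain u where "0 \<le> u" "u \<le> 1" "w = z (u * t)"
      using w by (auto simp: in_segment z_def algebra_simps)
    then show ?thesis
      using that(1) by (intro bexI[of _ "u * t"]) (auto intro: mult_left_le_one_le)
  qed
  have G_near: "norm (G (z t) - h) \<le> L * t * D" if "0 \<le> t" "\<forall>s\<in>{0..t}. P s" for t
  proof -
    have "w \<in> X \<and> norm (G w) \<le> norm h + D" if "w \<in> closed_segment (z 0) (z t)" for w
      using seg[OF \<open>0 \<le> t\<close> that] \<open>\<forall>s\<in>{0..t}. P s\<close> norm_triangle_sub[of "G w" h]
      by (fastforce simp: P_def)
    then have "norm (G (z t) - G (z 0)) \<le> ell (norm h + D) * norm (z t - z 0)"
      by (intro G_lipschitz_on_segment) auto
    then show ?thesis using that(1) zdiff[of t 0] by (simp add: z0 h_def L_def D_def mult.assoc)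
  qed
  have F_descent: "F (z t) \<le> F y - t * (h \<bullet> d) + L * t\<^sup>2 / 2 * D\<^sup>2"
    if t: "0 \<le> t" "\<forall>s\<in>{0..t}. P s" for t
  proof -
    let ?\<phi> = "\<lambda>s. F (z s) + s * (h \<bullet> d) - L * s\<^sup>2 / 2 * D\<^sup>2"
    have "?\<phi> t \<le> ?\<phi> 0"
    proof (rule DERIV_nonpos_imp_nonincreasing[OF t(1)])
      fix s assume s: "0 \<le> s" "s \<le> t"
      have "z s \<in> X" using t s by (auto simp: P_def)
      then have 1: "((\<lambda>s. F (z s)) has_real_derivative (- d) \<bullet> G (z s)) (at s)"
        unfolding z_def by (rule F_along_line)
      have "(?\<phi> has_real_derivative (- d) \<bullet> G (z s) + h \<bullet> d - L * s * D\<^sup>2) (at s)"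
        by (rule derivative_eq_intros 1 refl | simp)+
      moreover have "(- d) \<bullet> G (z s) + h \<bullet> d \<le> L * s * D\<^sup>2"
      proof -
        have "(- d) \<bullet> G (z s) + h \<bullet> d = d \<bullet> (h - G (z s))" by (simp add: inner_simps inner_commute)
        also have "\<dots> \<le> norm d * norm (h - G (z s))" by (rule norm_cauchy_schwarz)
        also have "\<dots> \<le> D * (L * s * D)"
          using G_near[of s] s t D by (intro mult_mono) (auto simp: D_def norm_minus_commute)
        finally show ?thesis by (simp add: power2_eq_square algebra_simps)
      qed
      ultimately show "\<exists>y. (?\<phi> has_real_derivative y) (at s) \<and> y \<le> 0"
        by (intro exI conjI) auto
    qed
    then show ?thesis by (simp add: z0)
  qed
  have P_all: "P t" if b: "b < 1 / L" "0 \<le> b" and t: "t \<in> {0..b}" for b t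
  proof (rule real_interval_induct[where P = P, OF _ _ _ t])
    show "P 0" using y D by (simp add: P_def z0 h_def)
  next
    fix s assume s: "0 \<le> s" "s < b" and Ps: "\<forall>t\<in>{0..s}. P t"
    have zX: "z s \<in> X" using Ps s by (auto simp: P_def)
    \<comment> \<open>Lengths strictly below \<open>1 / L\<close> leave slack in the gradient bound,
      which makes \<open>P\<close> an open condition.\<close>
    have "L * s < 1" using b(1) s(2) L mult_strict_left_mono[of s "1 / L" L] by simp
    then have "norm (G (z s) - h) < D"
      using G_near[OF s(1) Ps] D mult_strict_right_mono[of "L * s" 1 D] by linarith
    moreover have "isCont (\<lambda>s. norm (G (z s) - h)) s"
      by (intro continuous_intros isCont_o2[OF zcont continuous_G[OF zX]])
    ultimately have "\<forall>\<^sub>F t in at s. norm (G (z t) - h) < D"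
      by (auto simp: isCont_def dest: order_tendstoD)
    moreover have "\<forall>\<^sub>F t in at s. z t \<in> X"
      using zcont[of s] open_X zX unfolding isCont_def by (rule topological_tendstoD)
    ultimately have "\<forall>\<^sub>F t in at s. P t"
      by eventually_elim (simp add: P_def)
    then show "eventually P (at_right s)"
      by (simp add: eventually_at_split)
  next
    fix s assume s: "0 < s" "s \<le> b" and Ps: "\<forall>t\<in>{0..<s}. P t"
    have ev: "\<forall>\<^sub>F t in at_left s. t \<in> {0<..<s}"
      using eventually_at_leftI[of 0 s "\<lambda>t. t \<in> {0<..<s}"] s by auto
    have nb: "at_left s \<noteq> bot" by simp
    \<comment> \<open>A bound on \<open>F\<close> over all of the path before \<open>s\<close>, so
      that the closed sublevel set contains the limit point.\<close>
    define C where "C = F y + s * \<bar>h \<bullet> d\<bar> + L * s\<^sup>2 / 2 * D\<^sup>2"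
    have zl: "(z \<longlongrightarrow> z s) (at_left s)"
      using zcont[of s] by (simp add: isCont_def filterlim_at_split)
    have "\<forall>\<^sub>F t in at_left s. z t \<in> {x\<in>X. F x \<le> C}"
      using ev
    proof eventually_elim
      case (elim t)
      then have Pt: "\<forall>r\<in>{0..t}. P r" using Ps by auto
      have "- (t * (h \<bullet> d)) \<le> s * \<bar>h \<bullet> d\<bar>"
        using elim mult_right_mono[of t s "\<bar>h \<bullet> d\<bar>"] mult_left_mono[OF abs_ge_minus_self[of "h \<bullet> d"], of t]
        by simp
      moreover have "L * t\<^sup>2 / 2 * D\<^sup>2 \<le> L * s\<^sup>2 / 2 * D\<^sup>2"
        using elim L by (intro mult_right_mono divide_right_mono mult_left_mono power_mono) auto
      ultimately show ?case
        using F_descent[OF _ Pt] elim Pt by (auto simp: C_def P_def)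
    qed
    then have zs: "z s \<in> X"
      using Lim_in_closed_set[OF closed_sublevel _ nb zl] by blast
    have "((\<lambda>t. norm (G (z t) - h)) \<longlongrightarrow> norm (G (z s) - h)) (at_left s)"
      by (intro tendsto_intros isCont_tendsto_compose[OF continuous_G[OF zs] zl])
    moreover have "\<forall>\<^sub>F t in at_left s. norm (G (z t) - h) \<le> D"
      using ev by eventually_elim (use Ps in \<open>auto simp: P_def\<close>)
    ultimately have "norm (G (z s) - h) \<le> D"
      using nb by (rule tendsto_upperbound)
    with zs show "P s" by (simp add: P_def)
  qed
  have key: "F x + G x \<bullet> (y - x) + (b - L * b\<^sup>2 / 2) * D\<^sup>2 \<le> F y" if b: "0 < b" "b < 1 / L" for b
  proof -
    \<comment> \<open>The value at \<open>z b\<close> is bounded below by the tangent at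
      \<open>x\<close> and above by the descent from \<open>y\<close>.\<close>
    have Pb: "\<forall>s\<in>{0..b}. P s" using P_all b by auto
    have "F x + G x \<bullet> (z b - x) \<le> F (z b)"
      by (rule gradient_ineq[OF x]) (use Pb b in \<open>auto simp: P_def\<close>)
    also have "\<dots> \<le> F y - b * (h \<bullet> d) + L * b\<^sup>2 / 2 * D\<^sup>2"
      by (rule F_descent) (use Pb b in auto)
    finally have "F x + G x \<bullet> (y - x) + b * ((h - G x) \<bullet> d) - L * b\<^sup>2 / 2 * D\<^sup>2 \<le> F y"
      by (simp add: z_def inner_simps algebra_simps)
    moreover have "(h - G x) \<bullet> d = D\<^sup>2"
      by (simp add: D_def d_def power2_norm_eq_inner)
    ultimately show ?thesis by (simp add: algebra_simps)
  qed
  \<comment> \<open>The optimal length \<open>1 / L\<close> was excluded for the sake of the slack;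
    it is recovered as a limit.\<close>
  have "((\<lambda>b. F x + G x \<bullet> (y - x) + (b - L * b\<^sup>2 / 2) * D\<^sup>2) \<longlongrightarrow>
      F x + G x \<bullet> (y - x) + (1 / L - L * (1 / L)\<^sup>2 / 2) * D\<^sup>2) (at_left (1 / L))"
    by (intro tendsto_intros) auto
  moreover have "\<forall>\<^sub>F b in at_left (1 / L). F x + G x \<bullet> (y - x) + (b - L * b\<^sup>2 / 2) * D\<^sup>2 \<le> F y"
    using L key by (intro eventually_at_leftI[of 0]) auto
  ultimately have "F x + G x \<bullet> (y - x) + (1 / L - L * (1 / L)\<^sup>2 / 2) * D\<^sup>2 \<le> F y"
    by (rule tendsto_upperbound) simp
  moreover have "1 / L - L * (1 / L)\<^sup>2 / 2 = 1 / (2 * L)"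
    using L by (simp add: power2_eq_square field_simps)
  ultimately show ?thesis
    by (simp add: L_def D_def d_def h_def norm_minus_commute)
qed

lemma psi_gradient_le:
  assumes x: "x \<in> X" and y: "y \<in> X" and "G x = 0"
  shows "psi ell (norm (G y)) \<le> F y - F x"
proof -
  let ?g = "norm (G y)"
  have "ell (2 * ?g) \<le> ell (4 * ?g)"
    using ell_mono by (rule mono_onD) auto
  then have "?g\<^sup>2 / (2 * ell (4 * ?g)) \<le> ?g\<^sup>2 / (2 * ell (2 * ?g))"
    by (intro divide_left_mono) (auto intro!: ell_pos mult_pos_pos)
  moreover have "?g + ?g = 2 * ?g" by simp
  ultimately show ?thesis
    using co_coercive[OF x y] by (simp add: psi_def \<open>G x = 0\<close> del: distrib_left_numeral)
qed

text \<open>All terms linear in the new gradient cancel because \<open>\<alpha>\<^sup>2 = t \<Gamma>\<close> and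
  \<open>(1 + \<alpha>) y' = y + \<alpha> u - t \<nabla>F(y)\<close>.\<close>

lemma lyapunov_decrease:
  assumes y: "y \<in> X" and y': "y' \<in> X" and xs: "xs \<in> X" and \<Gamma>: "\<Gamma> > 0" and t: "t \<ge> 0"
    and \<alpha>: "\<alpha> = sqrt (t * \<Gamma>)"
    and y'_eq: "y' = (1 / (1 + \<alpha>)) *\<^sub>R y + (\<alpha> / (1 + \<alpha>)) *\<^sub>R u - (t / (1 + \<alpha>)) *\<^sub>R G y"
    and small: "t * ell (norm (G y) + norm (G y' - G y)) \<le> 1"
  shows "(1 + \<alpha>) * (F y' - F xs) + \<Gamma> / 2 * (norm (u - (\<alpha> / \<Gamma>) *\<^sub>R G y' - xs))\<^sup>2
           \<le> F y - F xs + \<Gamma> / 2 * (norm (u - xs))\<^sup>2"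
proof -
  define g h where "g = G y'" and "h = G y"
  have \<alpha>0: "\<alpha> \<ge> 0" "\<alpha>\<^sup>2 = t * \<Gamma>" using \<Gamma> t by (auto simp: \<alpha>)
  have "(1 + \<alpha>) *\<^sub>R y' = y + \<alpha> *\<^sub>R u - t *\<^sub>R h"
    using \<alpha>0(1) by (simp add: y'_eq h_def scaleR_add_right scaleR_diff_right)
  then have "g \<bullet> ((1 + \<alpha>) *\<^sub>R y') = g \<bullet> (y + \<alpha> *\<^sub>R u - t *\<^sub>R h)" by simp
  then have lin: "(1 + \<alpha>) * (g \<bullet> y') = g \<bullet> y + \<alpha> * (g \<bullet> u) - t * (g \<bullet> h)"
    by (simp add: inner_simps)
  \<comment> \<open>Co-coercivity with the new point as base point, so that the argument of
    \<open>ell\<close> starts from the gradient at \<open>y\<close>, which is already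
    controlled.\<close>
  have 1: "F y' + (g \<bullet> y - g \<bullet> y') + t / 2 * (norm (g - h))\<^sup>2 \<le> F y"
  proof -
    have L: "ell (norm h + norm (g - h)) > 0" by (intro ell_pos add_nonneg_nonneg norm_ge_zero)
    then have "t / 2 \<le> 1 / (2 * ell (norm h + norm (g - h)))"
      using small by (simp add: g_def h_def field_simps)
    then have "t / 2 * (norm (g - h))\<^sup>2 \<le> 1 / (2 * ell (norm h + norm (g - h))) * (norm (g - h))\<^sup>2"
      by (rule mult_right_mono) simp
    then show ?thesis
      using co_coercive[OF y' y] by (simp add: g_def h_def inner_simps)
  qed
  have 2: "\<alpha> * (F y' + (g \<bullet> xs - g \<bullet> y')) \<le> \<alpha> * F xs"
    using gradient_ineq[OF y' xs] \<alpha>0 by (intro mult_left_mono) (auto simp: g_def inner_simps)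
  have 3: "\<Gamma> / 2 * (norm (u - (\<alpha> / \<Gamma>) *\<^sub>R g - xs))\<^sup>2
      = \<Gamma> / 2 * (norm (u - xs))\<^sup>2 - \<alpha> * (g \<bullet> u - g \<bullet> xs) + t / 2 * (norm g)\<^sup>2"
  proof -
    have "(norm (u - b *\<^sub>R g - xs))\<^sup>2
        = (norm (u - xs))\<^sup>2 - 2 * b * (g \<bullet> u - g \<bullet> xs) + b\<^sup>2 * (norm g)\<^sup>2" for b
      unfolding power2_norm_eq_inner by (simp add: inner_simps inner_commute algebra_simps power2_eq_square)
    from this[of "\<alpha> / \<Gamma>"]
    have "\<Gamma> / 2 * (norm (u - (\<alpha> / \<Gamma>) *\<^sub>R g - xs))\<^sup>2
        = \<Gamma> / 2 * (norm (u - xs))\<^sup>2 - (\<Gamma> / 2 * (2 * (\<alpha> / \<Gamma>))) * (g \<bullet> u - g \<bullet> xs)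
          + (\<Gamma> / 2 * (\<alpha> / \<Gamma>)\<^sup>2) * (norm g)\<^sup>2"
      by (simp only: distrib_left right_diff_distrib mult.assoc)
    moreover have "\<Gamma> / 2 * (\<alpha> / \<Gamma>)\<^sup>2 = t / 2"
      using \<Gamma> \<alpha>0 by (simp add: power_divide power2_eq_square)
    moreover have "\<Gamma> / 2 * (2 * (\<alpha> / \<Gamma>)) = \<alpha>" using \<Gamma> by simp
    ultimately show ?thesis by (simp only:)
  qed
  \<comment> \<open>In the final sum \<open>norm g\<close> squared cancels against 3 and
    \<open>g \<bullet> h\<close> against \<open>lin\<close>; the remaining square of
    \<open>norm h\<close> is dropped by 5.\<close>
  have 4: "t / 2 * (norm (g - h))\<^sup>2 = t / 2 * (norm g)\<^sup>2 - t * (g \<bullet> h) + t / 2 * (norm h)\<^sup>2"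
    unfolding power2_norm_eq_inner by (simp add: inner_simps inner_commute algebra_simps)
  have 5: "0 \<le> t / 2 * (norm h)\<^sup>2" using t by simp
  show ?thesis
    using 1 2 3 4 5 lin unfolding g_def[symmetric] by (simp add: algebra_simps)
qed

text \<open>The step length grows continuously from \<open>0\<close> to \<open>\<gamma>\<close>. As long as the gradient at the new
  point has norm below \<open>2 M\<close>, the decrease of the Lyapunov function bounds the function
  value, hence keeps the point in \<open>X\<close> and improves the gradient bound to \<open>M\<close>.\<close>

lemma accelerated_step:
  assumes y: "y \<in> X" and xs: "xs \<in> X" "G xs = 0" and min: "\<And>x. x \<in> X \<Longrightarrow> F xs \<le> F x"
    and psi_mono: "strict_mono_on {0..} (psi ell)"
    and \<Gamma>: "\<Gamma> > 0" and M: "M > 0"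
    and V: "F y - F xs + \<Gamma> / 2 * (norm (u - xs))\<^sup>2 \<le> psi ell M"
    and \<gamma>: "\<gamma> = 1 / ell (4 * M)" and \<alpha>: "\<alpha> = sqrt (\<gamma> * \<Gamma>)"
    and y'_eq: "y' = (1 / (1 + \<alpha>)) *\<^sub>R y + (\<alpha> / (1 + \<alpha>)) *\<^sub>R u - (\<gamma> / (1 + \<alpha>)) *\<^sub>R G y"
  shows "y' \<in> X" (is ?A)
    and "(1 + \<alpha>) * (F y' - F xs) + \<Gamma> / 2 * (norm (u - (\<alpha> / \<Gamma>) *\<^sub>R G y' - xs))\<^sup>2
           \<le> F y - F xs + \<Gamma> / 2 * (norm (u - xs))\<^sup>2" (is ?B)
proof -
  define C where "C = F xs + psi ell M"
  define a where "a = (\<lambda>t. sqrt (t * \<Gamma>))"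
  \<comment> \<open>The length \<open>t\<close> replaces \<open>\<gamma>\<close> inside
    \<open>\<alpha>\<close> as well, so the Lyapunov decrease is available for every
    \<open>t\<close>, with \<open>Y 0 = y\<close> and \<open>Y \<gamma> = y'\<close>.\<close>
  define Y where "Y = (\<lambda>t. (1 / (1 + a t)) *\<^sub>R y + (a t / (1 + a t)) *\<^sub>R u - (t / (1 + a t)) *\<^sub>R G y)"
  define P where "P = (\<lambda>t. Y t \<in> X \<and> F (Y t) \<le> C)"
  have L: "ell (4 * M) > 0" using M by (intro ell_pos) simp
  then have \<gamma>0: "\<gamma> > 0" by (simp add: \<gamma>)
  have G_le: "norm (G x) \<le> M" if "x \<in> X" "F x \<le> C" for x
  proof -
    have "psi ell (norm (G x)) \<le> psi ell M"
      using psi_gradient_le[OF xs(1) that(1) xs(2)] that(2) by (simp add: C_def)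
    then show ?thesis
      using strict_mono_on_less_eq[OF psi_mono, of "norm (G x)" M] M by simp
  qed
  have "0 \<le> \<Gamma> / 2 * (norm (u - xs))\<^sup>2" using \<Gamma> by simp
  then have yC: "F y \<le> C" using V unfolding C_def by linarith
  have decrease: "(1 + a t) * (F (Y t) - F xs) + \<Gamma> / 2 * (norm (u - (a t / \<Gamma>) *\<^sub>R G (Y t) - xs))\<^sup>2
           \<le> F y - F xs + \<Gamma> / 2 * (norm (u - xs))\<^sup>2"
    if "0 \<le> t" "t \<le> \<gamma>" "Y t \<in> X" "norm (G (Y t)) \<le> 2 * M" for t
  proof (rule lyapunov_decrease[OF y \<open>Y t \<in> X\<close> xs(1) \<Gamma> \<open>0 \<le> t\<close> a_def[THEN fun_cong] Y_def[THEN fun_cong]])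
    \<comment> \<open>The sum is at most \<open>M + (2 * M + M)\<close>, which explains the factor 4
      in the step size.\<close>
    have "norm (G y) + norm (G (Y t) - G y) \<le> 4 * M"
      using G_le[OF y yC] that(4) norm_triangle_ineq4[of "G (Y t)" "G y"] by simp
    then have "ell (norm (G y) + norm (G (Y t) - G y)) \<le> ell (4 * M)"
      using ell_mono M by (intro mono_onD[OF ell_mono]) auto
    then have "t * ell (norm (G y) + norm (G (Y t) - G y)) \<le> \<gamma> * ell (4 * M)"
      using that \<gamma>0 by (intro mult_mono) (auto intro!: less_imp_le[OF ell_pos])
    also have "\<dots> = 1" using L by (simp add: \<gamma>)
    finally show "t * ell (norm (G y) + norm (G (Y t) - G y)) \<le> 1" .
  qed
  have a_nonneg: "a t \<ge> 0" if "t \<ge> 0" for t using that \<Gamma> by (simp add: a_def)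
  have Y_cont: "isCont Y t" if "t \<ge> 0" for t
    using a_nonneg[OF that] unfolding Y_def a_def
    by (intro continuous_intros) (simp_all add: add_nonneg_eq_0_iff)
  have "P \<gamma>"
  proof (rule real_interval_induct[where P = P and a = 0 and b = \<gamma>])
    show "P 0" using y yC by (simp add: P_def Y_def a_def)
  next
    fix s assume s: "0 \<le> s" "s < \<gamma>" and Ps: "\<forall>t\<in>{0..s}. P t"
    have Ys: "Y s \<in> X" "F (Y s) \<le> C" using Ps s by (auto simp: P_def)
    have "isCont (\<lambda>t. norm (G (Y t))) s"
      by (intro continuous_intros isCont_o2[OF Y_cont[OF s(1)] continuous_G[OF Ys(1)]])
    \<comment> \<open>The gap between \<open>M\<close> and \<open>2 * M\<close> keeps the gradient
      bound valid a little beyond \<open>s\<close>.\<close>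
    moreover have "norm (G (Y s)) < 2 * M" using G_le[OF Ys] M by simp
    ultimately have "\<forall>\<^sub>F t in at s. norm (G (Y t)) < 2 * M"
      by (auto simp: isCont_def dest: order_tendstoD)
    moreover have "\<forall>\<^sub>F t in at s. Y t \<in> X"
      using Y_cont[OF s(1)] open_X Ys(1) unfolding isCont_def by (rule topological_tendstoD)
    ultimately have "\<forall>\<^sub>F t in at_right s. norm (G (Y t)) < 2 * M \<and> Y t \<in> X"
      by (simp add: eventually_at_split eventually_conj_iff)
    moreover have "\<forall>\<^sub>F t in at_right s. t \<in> {s<..<\<gamma>}"
      using eventually_at_right_real[OF s(2)] .
    ultimately show "eventually P (at_right s)"
    proof eventually_elim
      case (elim t)
      then have t: "0 \<le> t" "t \<le> \<gamma>" using s by auto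
      have "0 \<le> \<Gamma> / 2 * (norm (u - (a t / \<Gamma>) *\<^sub>R G (Y t) - xs))\<^sup>2" using \<Gamma> by simp
      then have "(1 + a t) * (F (Y t) - F xs) \<le> psi ell M"
        using decrease[OF t] elim V by linarith
      moreover have "1 * (F (Y t) - F xs) \<le> (1 + a t) * (F (Y t) - F xs)"
        using min[of "Y t"] elim a_nonneg[OF t(1)] by (intro mult_right_mono) auto
      ultimately show ?case using elim by (simp add: P_def C_def)
    qed
  next
    fix s assume s: "0 < s" "s \<le> \<gamma>" and Ps: "\<forall>t\<in>{0..<s}. P t"
    have "\<forall>\<^sub>F t in at_left s. Y t \<in> {x\<in>X. F x \<le> C}"
      by (rule eventually_at_leftI[of 0 s]) (use Ps s in \<open>auto simp: P_def\<close>)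
    moreover have "(Y \<longlongrightarrow> Y s) (at_left s)"
      using Y_cont[of s] s by (simp add: isCont_def filterlim_at_split)
    ultimately have "Y s \<in> {x\<in>X. F x \<le> C}"
      by (intro Lim_in_closed_set[OF closed_sublevel, where f = Y]) auto
    then show "P s" by (simp add: P_def)
  qed (use \<gamma>0 in auto)
  moreover have "Y \<gamma> = y'" "a \<gamma> = \<alpha>" by (auto simp: Y_def y'_eq a_def \<alpha>)
  ultimately show ?A ?B
    using decrease[of \<gamma>] G_le[of y'] M \<gamma>0 by (auto simp: P_def)
qed

end

section \<open>Decay of the step parameters\<close>

locale psi_regular =
  fixes ell :: "real \<Rightarrow> real"
  assumes ell_mono: "mono_on {0..} ell" and ell_pos: "\<And>s. 0 \<le> s \<Longrightarrow> 0 < ell s"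
    and ell_cont: "continuous_on {0..} ell"
    and psi_mono: "strict_mono_on {0..} (psi ell)" and psi_top: "filterlim (psi ell) at_top at_top"
begin

text \<open>\<open>psi ell\<close> is continuous, vanishes at 0 and is unbounded, so the
  intermediate value theorem yields a preimage for \<open>inv_into\<close> to choose.\<close>

lemma psi_inv:
  assumes "q \<ge> 0"
  shows "psi_inv ell q \<ge> 0" and "psi ell (psi_inv ell q) = q"
proof -
  have "\<forall>\<^sub>F x in at_top. psi ell x \<ge> q \<and> x \<ge> 0"
    using psi_top eventually_ge_at_top[of 0] by (auto simp: filterlim_at_top eventually_conj_iff)
  then obtain b where b: "psi ell b \<ge> q" "b \<ge> 0"
    using eventually_happens[of _ "at_top :: real filter"] by auto
  have "continuous_on {0..b} (\<lambda>x. ell (4 * x))"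
    by (rule continuous_on_compose2[OF ell_cont]) (auto intro!: continuous_intros)
  then have "continuous_on {0..b} (psi ell)"
    unfolding psi_def[abs_def] using ell_pos
    by (intro continuous_intros) (auto simp: less_imp_neq[symmetric])
  with b obtain x where "x \<ge> 0" "psi ell x = q"
    using IVT'[of "psi ell" 0 q b] assms by (auto simp: psi_def)
  then have "q \<in> psi ell ` {0..}" by auto
  then show "psi_inv ell q \<ge> 0" "psi ell (psi_inv ell q) = q"
    unfolding psi_inv_def using inv_into_into[of q "psi ell" "{0..}"] by (auto intro: f_inv_into_f)
qed

lemma psi_inv_le:
  assumes "q \<ge> 0" "w \<ge> 0" "q \<le> psi ell w"
  shows "psi_inv ell q \<le> w"
  using strict_mono_on_less_eq[OF psi_mono, of "psi_inv ell q" w] psi_inv[OF assms(1)] assms by simp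

lemma psi_inv_pos: "0 < q \<Longrightarrow> psi_inv ell q > 0"
  using psi_inv[of q] by (cases "psi_inv ell q = 0") (auto simp: psi_def)

lemma step_gamma_pos: "q \<ge> 0 \<Longrightarrow> step_gamma ell Rbar q > 0"
  unfolding step_gamma_def by (intro divide_pos_pos ell_pos mult_nonneg_nonneg psi_inv) auto

text \<open>Turns any upper estimate \<open>c\<close> of the inverse of \<open>psi\<close> into a
  lower bound on the step size, by monotonicity of \<open>ell\<close>.\<close>

lemma step_gamma_ge:
  assumes "q \<ge> 0" "c \<ge> 0" "q * Rbar\<^sup>2 \<le> psi ell c"
  shows "step_gamma ell Rbar q \<ge> 1 / ell (4 * c)"
proof -
  have q: "q * Rbar\<^sup>2 \<ge> 0" using assms by simp
  have "ell (4 * psi_inv ell (q * Rbar\<^sup>2)) \<le> ell (4 * c)"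
    using assms psi_inv_le[OF q] psi_inv[OF q] by (intro mono_onD[OF ell_mono]) auto
  then show ?thesis
    unfolding step_gamma_def using psi_inv[OF q]
    by (intro divide_left_mono mult_pos_pos ell_pos) (use assms in auto)
qed

lemma step_gamma_le: "q \<ge> 0 \<Longrightarrow> step_gamma ell Rbar q \<le> 1 / ell 0"
  using psi_inv[of "q * Rbar\<^sup>2"] unfolding step_gamma_def
  by (intro divide_left_mono mult_pos_pos ell_pos mono_onD[OF ell_mono]) auto

lemma step_alpha_nonneg: "q \<ge> 0 \<Longrightarrow> step_alpha ell Rbar q \<ge> 0"
  using step_gamma_pos[of q Rbar] by (simp add: step_alpha_def)

text \<open>The \<open>LEAST\<close> is attained: the argument of \<open>ell\<close> tends to 0 as
  \<open>k\<close> grows, \<open>ell\<close> is continuous, and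
  \<open>ell 0 < 2 * ell 0\<close>.\<close>

lemma k_init:
  fixes \<Gamma>0 Rbar :: real
  assumes "\<Gamma>0 \<ge> 0"
  shows "k_init ell \<Gamma>0 Rbar > 0"
    and "ell (24 * sqrt (ell (4 * psi_inv ell (\<Gamma>0 * Rbar\<^sup>2)) * ell 0 * Rbar\<^sup>2
           / (real (k_init ell \<Gamma>0 Rbar))\<^sup>2)) \<le> 2 * ell 0"
proof -
  define c where "c = ell (4 * psi_inv ell (\<Gamma>0 * Rbar\<^sup>2)) * ell 0 * Rbar\<^sup>2"
  define Q where "Q = (\<lambda>k::nat. 0 < k \<and> ell (24 * sqrt (c / (real k)\<^sup>2)) \<le> 2 * ell 0)"
  have e0: "ell 0 > 0" by (rule ell_pos) simp
  have "c \<ge> 0"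
    unfolding c_def using psi_inv[of "\<Gamma>0 * Rbar\<^sup>2"] assms e0
    by (intro mult_nonneg_nonneg) (auto intro!: less_imp_le[OF ell_pos])
  have "\<exists>k. Q k"
  proof -
    have "(\<lambda>k::nat. 24 * sqrt (c / (real k)\<^sup>2)) \<longlonglongrightarrow> 24 * sqrt 0"
      by (intro tendsto_intros real_tendsto_divide_at_top[OF tendsto_const]
            filterlim_pow_at_top filterlim_real_sequentially) auto
    then have "(\<lambda>k::nat. ell (24 * sqrt (c / (real k)\<^sup>2))) \<longlonglongrightarrow> ell 0"
      using \<open>c \<ge> 0\<close> by (intro continuous_on_tendsto_compose[OF ell_cont]) auto
    then have "\<forall>\<^sub>F k in sequentially. ell (24 * sqrt (c / (real k)\<^sup>2)) < 2 * ell 0"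
      using e0 by (intro order_tendstoD) auto
    then have "\<forall>\<^sub>F k in sequentially. Q k"
      using eventually_gt_at_top[of 0] by eventually_elim (simp add: Q_def)
    then show ?thesis using eventually_happens by fastforce
  qed
  then have "Q (LEAST k. Q k)" by (rule LeastI_ex)
  then show "k_init ell \<Gamma>0 Rbar > 0"
    and "ell (24 * sqrt (ell (4 * psi_inv ell (\<Gamma>0 * Rbar\<^sup>2)) * ell 0 * Rbar\<^sup>2
           / (real (k_init ell \<Gamma>0 Rbar))\<^sup>2)) \<le> 2 * ell 0"
    by (simp_all add: Q_def k_init_def c_def)
qed

end

locale agd_parameters = psi_regular +
  fixes \<Gamma>0 Rbar :: real
  assumes \<Gamma>0: "\<Gamma>0 > 0" and Rbar: "Rbar > 0"
begin

abbreviation Gam :: "nat \<Rightarrow> real" where "Gam \<equiv> agd_Gamma ell \<Gamma>0 Rbar"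
abbreviation alpha :: "nat \<Rightarrow> real" where "alpha k \<equiv> step_alpha ell Rbar (Gam k)"
abbreviation gamma :: "nat \<Rightarrow> real" where "gamma k \<equiv> step_gamma ell Rbar (Gam k)"

lemma Gam_pos: "Gam k > 0"
proof (induction k)
  case (Suc k)
  then show ?case using step_alpha_nonneg[of "Gam k" Rbar] by (simp add: add_pos_nonneg)
qed (simp add: \<Gamma>0)

lemma alpha_nonneg: "alpha k \<ge> 0"
  by (intro step_alpha_nonneg less_imp_le Gam_pos)

lemma gamma_pos: "gamma k > 0"
  by (intro step_gamma_pos less_imp_le Gam_pos)

lemma Gam_Suc_le: "Gam (Suc k) \<le> Gam k"
  using Gam_pos[of k] alpha_nonneg[of k] by (simp add: divide_le_eq mult_le_cancel_left1 add_pos_nonneg)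

lemma Gam_le: "Gam k \<le> \<Gamma>0"
  by (induction k) (use Gam_Suc_le order_trans in \<open>auto simp del: agd_Gamma.simps(2)\<close>)

lemma gamma_ge_initial: "gamma k \<ge> 1 / ell (4 * psi_inv ell (\<Gamma>0 * Rbar\<^sup>2))"
  using \<Gamma>0 Gam_pos[of k] Gam_le[of k] psi_inv[of "\<Gamma>0 * Rbar\<^sup>2"]
  by (intro step_gamma_ge) (auto intro!: mult_right_mono)

section \<open>Counting long and short steps\<close>

definition long_steps :: "nat \<Rightarrow> nat" where
  "long_steps k = (\<Sum>i<k. if alpha i > 3 then 1 else 0)"

definition short_steps :: "nat \<Rightarrow> nat" where
  "short_steps k = (\<Sum>i<k. if alpha i > 3 then 0 else 1)"

lemma steps_total: "long_steps k + short_steps k = k"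
  by (induction k) (auto simp: long_steps_def short_steps_def)

lemma alpha_square: "(alpha k)\<^sup>2 = gamma k * Gam k"
  using gamma_pos[of k] Gam_pos[of k] by (simp add: step_alpha_def)

text \<open>A long step divides \<open>Gam\<close> by more than 4; only the factor 3/2 is kept, the
  base of the logarithm in the final bound.\<close>

lemma Gam_long_steps: "Gam k * (3/2) ^ long_steps k \<le> \<Gamma>0"
proof (induction k)
  case (Suc k)
  show ?case
  proof (cases "alpha k > 3")
    case True
    then have "Gam (Suc k) * (3/2) \<le> Gam k"
      using Gam_pos[of k] by (simp add: field_simps)
    then have "(Gam (Suc k) * (3/2)) * (3/2) ^ long_steps k \<le> Gam k * (3/2) ^ long_steps k"
      by (rule mult_right_mono) simp
    with Suc True show ?thesis by (simp add: long_steps_def)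
  next
    case False
    have "Gam (Suc k) * (3/2) ^ long_steps k \<le> Gam k * (3/2) ^ long_steps k"
      by (rule mult_right_mono[OF Gam_Suc_le]) simp
    with Suc False show ?thesis by (simp add: long_steps_def)
  qed
qed (simp add: long_steps_def)

text \<open>A long step is only possible while \<open>\<Gamma>\<^sub>k > 9 \<ell>(0)\<close>, because \<open>\<gamma>\<^sub>k \<le> 1 / \<ell>(0)\<close>.\<close>

lemma long_steps_power: "long_steps k = 0 \<or> 4 * ell 0 * (3/2) ^ (long_steps k - 1) \<le> \<Gamma>0"
proof (induction k)
  case (Suc k)
  show ?case
  proof (cases "alpha k > 3")
    case True
    have e0: "ell 0 > 0" by (rule ell_pos) simp
    have "9 < (alpha k)\<^sup>2" using power_strict_mono[OF True, of 2] by simp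
    also have "\<dots> \<le> 1 / ell 0 * Gam k"
      unfolding alpha_square using Gam_pos[of k] by (intro mult_right_mono step_gamma_le) auto
    \<comment> \<open>This is \<open>Gam\<close> before the current long step, hence the exponent
      one below the new count.\<close>
    finally have "4 * ell 0 \<le> Gam k" using e0 by (simp add: field_simps)
    then have "4 * ell 0 * (3/2) ^ long_steps k \<le> Gam k * (3/2) ^ long_steps k"
      by (rule mult_right_mono) simp
    also have "\<dots> \<le> \<Gamma>0" by (rule Gam_long_steps)
    finally show ?thesis using True by (simp add: long_steps_def)
  qed (use Suc in \<open>simp add: long_steps_def\<close>)
qed (simp add: long_steps_def)

lemma long_steps_le: "real (long_steps k) \<le> max (2 + log (3/2) (\<Gamma>0 / (4 * ell 0))) 0"
proof (cases "long_steps k = 0")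
  case False
  have e0: "ell 0 > 0" by (rule ell_pos) simp
  have "(3/2) ^ (long_steps k - 1) \<le> \<Gamma>0 / (4 * ell 0)"
    using long_steps_power[of k] False e0 by (simp only: pos_le_divide_eq) (simp add: mult_ac)
  then have "(3/2) powr real (long_steps k - 1) \<le> \<Gamma>0 / (4 * ell 0)"
    by (subst powr_realpow) auto
  then have "real (long_steps k - 1) \<le> log (3/2) (\<Gamma>0 / (4 * ell 0))"
    using e0 \<Gamma>0 by (subst le_log_iff) auto
  with False show ?thesis by (simp add: of_nat_diff)
qed simp

section \<open>Growth of \<open>1 / sqrt (Gam k)\<close> and the resulting rate\<close>

lemma inverse_sqrt_Gam_mono: "1 / sqrt (Gam k) \<le> 1 / sqrt (Gam (Suc k))"
  using Gam_Suc_le[of k] Gam_pos[of k] Gam_pos[of "Suc k"]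
  by (intro divide_left_mono mult_pos_pos) (auto simp del: agd_Gamma.simps)

text \<open>The quotient of the two inverse roots is \<open>sqrt (1 + alpha k)\<close>. For
  nonnegative \<open>a\<close>, \<open>1 + a / 3 \<le> sqrt (1 + a)\<close> holds exactly up to
  \<open>a = 3\<close>, which fixes the threshold between short and long steps.\<close>

lemma inverse_sqrt_Gam_Suc:
  assumes "alpha k \<le> 3"
  shows "1 / sqrt (Gam k) + sqrt (gamma k) / 3 \<le> 1 / sqrt (Gam (Suc k))"
proof -
  have a: "alpha k \<ge> 0" by (rule alpha_nonneg)
  have "(1 + alpha k / 3)\<^sup>2 \<le> 1 + alpha k"
    using a assms mult_left_mono[of "alpha k" 3 "alpha k"] by (simp add: power2_eq_square field_simps)
  then have "1 + alpha k / 3 \<le> sqrt (1 + alpha k)" by (rule real_le_rsqrt)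
  then have "(1 + alpha k / 3) / sqrt (Gam k) \<le> sqrt (1 + alpha k) / sqrt (Gam k)"
    using Gam_pos[of k] by (intro divide_right_mono) auto
  moreover have "alpha k / sqrt (Gam k) = sqrt (gamma k)"
    using Gam_pos[of k] by (simp add: step_alpha_def real_sqrt_mult)
  moreover have "sqrt (1 + alpha k) / sqrt (Gam k) = 1 / sqrt (Gam (Suc k))"
    by (simp add: real_sqrt_divide)
  ultimately show ?thesis by (simp add: add_divide_distrib)
qed

text \<open>Every short step after the first \<open>n\<close> contributes \<open>c / 3\<close>, and
  long steps lose nothing. It is used with \<open>n = 0\<close> and the initial step size, then with
  \<open>n = k_init\<close> and the improved one.\<close>

lemma inverse_sqrt_Gam_ge:
  assumes "c \<ge> 0" and "\<And>i. i < k \<Longrightarrow> c\<^sup>2 \<le> gamma i \<or> short_steps i < n"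
  shows "(real (short_steps k) - real n) * c / 3 \<le> 1 / sqrt (Gam k)"
  using assms(2)
proof (induction k)
  case 0
  show ?case using \<Gamma>0 \<open>c \<ge> 0\<close> by (simp add: short_steps_def order_trans[of _ 0])
next
  case (Suc k)
  then have IH: "(real (short_steps k) - real n) * c / 3 \<le> 1 / sqrt (Gam k)" by simp
  consider "alpha k > 3" | "alpha k \<le> 3" "c\<^sup>2 \<le> gamma k" | "alpha k \<le> 3" "short_steps k < n"
    using Suc.prems[of k] by fastforce
  then show ?case
  proof cases
    case 1
    then have "short_steps (Suc k) = short_steps k" by (simp add: short_steps_def)
    then show ?thesis using IH inverse_sqrt_Gam_mono[of k] by (simp del: agd_Gamma.simps)
  next
    case 2
    then have "short_steps (Suc k) = Suc (short_steps k)" by (simp add: short_steps_def)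
    moreover have "c \<le> sqrt (gamma k)" using 2 by (simp add: real_le_rsqrt)
    ultimately show ?thesis
      using IH inverse_sqrt_Gam_Suc[OF 2(1)] by (simp add: field_simps del: agd_Gamma.simps)
  next
    case 3
    then have "short_steps (Suc k) \<le> n" by (simp add: short_steps_def)
    then have "real (short_steps (Suc k)) - real n \<le> 0" by simp
    then have "(real (short_steps (Suc k)) - real n) * c / 3 \<le> 0"
      using \<open>c \<ge> 0\<close> by (simp add: mult_nonpos_nonneg)
    also have "0 \<le> 1 / sqrt (Gam (Suc k))" using Gam_pos[of "Suc k"] by (simp del: agd_Gamma.simps)
    finally show ?thesis .
  qed
qed

lemma gamma_ge_late:
  assumes "k_init ell \<Gamma>0 Rbar \<le> short_steps k"
  shows "1 / (2 * ell 0) \<le> gamma k"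
proof -
  define n where "n = real (k_init ell \<Gamma>0 Rbar)"
  define L0 where "L0 = ell (4 * psi_inv ell (\<Gamma>0 * Rbar\<^sup>2))"
  \<comment> \<open>Chosen so that \<open>4 * w\<close> is the argument of \<open>ell\<close> in
    \<open>k_init\<close>, while the square of \<open>w\<close> over \<open>4 * ell 0\<close> is
    exactly the bound on \<open>Gam k * Rbar\<^sup>2\<close> derived below.\<close>
  define w where "w = 6 * sqrt (L0 * ell 0 * Rbar\<^sup>2 / n\<^sup>2)"
  have n: "n > 0" unfolding n_def using k_init(1) \<Gamma>0 by simp
  have e0: "ell 0 > 0" by (rule ell_pos) simp
  have L0: "L0 > 0" unfolding L0_def using psi_inv[of "\<Gamma>0 * Rbar\<^sup>2"] \<Gamma>0 by (intro ell_pos) simp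
  have w0: "w \<ge> 0" using L0 e0 by (simp add: w_def)
  have ew: "ell (4 * w) \<le> 2 * ell 0" "ell (4 * w) > 0"
    using k_init(2)[of \<Gamma>0 Rbar] \<Gamma>0 w0 by (auto simp: w_def L0_def n_def intro: ell_pos)
  have "(real (short_steps k) - real 0) * (1 / sqrt L0) / 3 \<le> 1 / sqrt (Gam k)"
    using L0 gamma_ge_initial by (intro inverse_sqrt_Gam_ge) (auto simp: L0_def power_divide)
  moreover have "n * (1 / sqrt L0) / 3 \<le> (real (short_steps k) - real 0) * (1 / sqrt L0) / 3"
    using L0 assms by (intro divide_right_mono mult_right_mono) (auto simp: n_def)
  ultimately have "n * (1 / sqrt L0) / 3 \<le> 1 / sqrt (Gam k)" by simp
  then have "n * sqrt (Gam k) \<le> 3 * sqrt L0"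
    using L0 Gam_pos[of k] by (simp add: field_simps)
  then have "(n * sqrt (Gam k))\<^sup>2 \<le> (3 * sqrt L0)\<^sup>2"
    using n Gam_pos[of k] by (intro power_mono) auto
  then have "n\<^sup>2 * Gam k \<le> 9 * L0"
    using L0 Gam_pos[of k] by (simp add: power_mult_distrib)
  then have "n\<^sup>2 * Gam k * Rbar\<^sup>2 \<le> 9 * L0 * Rbar\<^sup>2" by (rule mult_right_mono) simp
  then have "Gam k * Rbar\<^sup>2 \<le> 9 * L0 * Rbar\<^sup>2 / n\<^sup>2"
    using n by (simp add: field_simps)
  also have "\<dots> = w\<^sup>2 / (2 * (2 * ell 0))"
    using L0 e0 by (simp add: w_def power_mult_distrib)
  also have "\<dots> \<le> psi ell w"
    unfolding psi_def using ew e0 by (intro divide_left_mono) auto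
  finally have "gamma k \<ge> 1 / ell (4 * w)"
    using Gam_pos[of k] w0 by (intro step_gamma_ge) auto
  moreover have "1 / (2 * ell 0) \<le> 1 / ell (4 * w)"
    using ew e0 by (intro divide_left_mono) auto
  ultimately show ?thesis by simp
qed

lemma Gam_rate:
  assumes R: "R \<ge> 0" and \<epsilon>: "\<epsilon> > 0"
    and N: "5 * sqrt (ell 0) * R / sqrt \<epsilon> + max (2 + log (3/2) (\<Gamma>0 / (4 * ell 0))) 0
              + real (k_init ell \<Gamma>0 Rbar) \<le> real N"
  shows "Gam N * R\<^sup>2 \<le> \<epsilon>"
proof -
  let ?n = "k_init ell \<Gamma>0 Rbar"
  have e0: "ell 0 > 0" by (rule ell_pos) simp
  define c where "c = 1 / sqrt (2 * ell 0)"
  have c: "c > 0" "c\<^sup>2 = 1 / (2 * ell 0)" using e0 by (auto simp: c_def power_divide)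
  have "real N = real (long_steps N) + real (short_steps N)"
    using steps_total[of N] by (metis of_nat_add)
  \<comment> \<open>The logarithmic term of the bound pays for the long steps and
    \<open>k_init\<close> for the early short ones; the rest are late short steps.\<close>
  then have "5 * sqrt (ell 0) * R / sqrt \<epsilon> \<le> real (short_steps N) - real ?n"
    using long_steps_le[of N] N by linarith
  then have "5 * sqrt (ell 0) * R / sqrt \<epsilon> * c / 3 \<le> (real (short_steps N) - real ?n) * c / 3"
    using c by (intro divide_right_mono mult_right_mono) auto
  also have "\<dots> \<le> 1 / sqrt (Gam N)"
    using c gamma_ge_late by (intro inverse_sqrt_Gam_ge) (auto simp: not_less)
  finally have "5 * sqrt (ell 0) * c * R / sqrt \<epsilon> / 3 \<le> 1 / sqrt (Gam N)"
    by (simp add: mult_ac)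
  moreover have "5 * sqrt (ell 0) * c = 5 / sqrt 2"
    using e0 by (simp add: c_def real_sqrt_mult)
  ultimately have "5 / sqrt 2 * (R / sqrt \<epsilon>) / 3 \<le> 1 / sqrt (Gam N)"
    by (simp only: times_divide_eq_right)
  moreover have "sqrt 2 \<le> 5/3"
    by (rule real_le_lsqrt) (simp_all add: power2_eq_square)
  then have "3 \<le> 5 / sqrt 2" by (simp add: field_simps)
  then have "3 * (R / sqrt \<epsilon>) \<le> 5 / sqrt 2 * (R / sqrt \<epsilon>)"
    using R \<epsilon> by (intro mult_right_mono) auto
  then have "R / sqrt \<epsilon> \<le> 5 / sqrt 2 * (R / sqrt \<epsilon>) / 3"
    by (subst pos_le_divide_eq) (simp_all only: mult.commute[of _ 3] zero_less_numeral)
  ultimately have "R / sqrt \<epsilon> \<le> 1 / sqrt (Gam N)" by (rule order_trans[rotated])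
  then have "sqrt (Gam N) * R \<le> sqrt \<epsilon>"
    using \<epsilon> Gam_pos[of N] by (simp add: field_simps)
  then have "(sqrt (Gam N) * R)\<^sup>2 \<le> (sqrt \<epsilon>)\<^sup>2"
    using R Gam_pos[of N] by (intro power_mono) auto
  then show ?thesis using \<epsilon> Gam_pos[of N] by (simp add: power_mult_distrib)
qed

end

section \<open>Convergence of the iterates\<close>

lemma GDERIV_gradient:
  fixes f :: "'a::euclidean_space \<Rightarrow> ereal"
  assumes "fin_part f differentiable (at x)"
  shows "GDERIV (fin_part f) x :> gradient f x"
proof -
  obtain f' where f': "(fin_part f has_derivative f') (at x)"
    using assms by (auto simp: differentiable_def)
  \<comment> \<open>The Riesz representative of the derivative, written through the adjoint of a
    real-valued linear map.\<close>
  have "v \<bullet> adjoint f' 1 = f' v" for v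
    using adjoint_works[of f' v 1] has_derivative_linear[OF f'] by simp
  then have D: "GDERIV (fin_part f) x :> adjoint f' 1"
    using f' by (simp add: gderiv_def)
  have "D' = adjoint f' 1" if "GDERIV (fin_part f) x :> D'" for D'
  proof -
    have "(\<lambda>h. h \<bullet> D') = (\<lambda>h. h \<bullet> adjoint f' 1)"
      using has_derivative_unique that D by (auto simp: gderiv_def)
    then show ?thesis by (metis vector_eq_ldot)
  qed
  with D show ?thesis unfolding gradient_def by (rule theI)
qed

lemma ereal_fin_part: "f x \<noteq> -\<infinity> \<Longrightarrow> x \<in> edom f \<Longrightarrow> ereal (fin_part f x) = f x"
  by (cases "f x") (auto simp: edom_def fin_part_def)

lemma convex_on_fin_part:
  assumes fin: "\<forall>x. f x \<noteq> -\<infinity>" and "convex (edom f)" and "convex_ereal_fun f"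
  shows "convex_on (edom f) (fin_part f)"
proof (rule convex_onI)
  fix t :: real and x y
  assume t: "0 < t" "t < 1" and xy: "x \<in> edom f" "y \<in> edom f"
  have z: "(1 - t) *\<^sub>R x + t *\<^sub>R y \<in> edom f"
    using convexD_alt[OF assms(2) xy] t by simp
  have "f ((1 - t) *\<^sub>R x + t *\<^sub>R y) \<le> ereal (1 - t) * f x + ereal t * f y"
    using assms(3) t by (simp add: convex_ereal_fun_def)
  then show "fin_part f ((1 - t) *\<^sub>R x + t *\<^sub>R y) \<le> (1 - t) * fin_part f x + t * fin_part f y"
    unfolding ereal_fin_part[OF fin[rule_format] z, symmetric]
      ereal_fin_part[OF fin[rule_format] xy(1), symmetric] ereal_fin_part[OF fin[rule_format] xy(2), symmetric]
    by simp
qed (rule assms)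

lemma gen_smooth_fin_part:
  fixes f :: "real^'d \<Rightarrow> ereal"
  assumes fin: "\<forall>x. f x \<noteq> -\<infinity>" and "open (edom f)" and "convex (edom f)"
    and "convex_ereal_fun f" and smooth: "ell_smooth ell f"
  shows "gen_smooth (edom f) (fin_part f) (gradient f) (\<lambda>x v. hessian f x *v v) ell"
proof
  show "closed {x \<in> edom f. fin_part f x \<le> C}" for C
  proof -
    \<comment> \<open>Points of the closure outside the domain have value infinity, so the preimage
      adds none of them.\<close>
    have "{x \<in> edom f. fin_part f x \<le> C} = closure (edom f) \<inter> f -` {..ereal C}"
    proof (intro set_eqI iffI)
      fix x assume "x \<in> {x \<in> edom f. fin_part f x \<le> C}"
      then show "x \<in> closure (edom f) \<inter> f -` {..ereal C}"
        using ereal_fin_part[of f x] fin closure_subset[of "edom f"] by (auto simp flip: ereal_less_eq(3))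
    next
      fix x assume x: "x \<in> closure (edom f) \<inter> f -` {..ereal C}"
      then have "x \<in> edom f" by (cases "f x") (auto simp: edom_def)
      then show "x \<in> {x \<in> edom f. fin_part f x \<le> C}"
        using x ereal_fin_part[of f x] fin by (auto simp flip: ereal_less_eq(3))
    qed
    also have "closed \<dots>"
      using smooth by (intro continuous_closed_preimage) (auto simp: ell_smooth_def)
    finally show ?thesis .
  qed
  show "(gradient f has_derivative (*v) (hessian f x)) (at x)" if "x \<in> edom f" for x
    using smooth that jacobian_works[of "gradient f" "at x"] by (simp add: ell_smooth_def hessian_def)
  show "onorm ((*v) (hessian f x)) \<le> ell (norm (gradient f x))" if "x \<in> edom f" for x
    using smooth that by (auto simp: ell_smooth_def spectral_norm_def)
  show "convex_on (edom f) (fin_part f)" by (intro convex_on_fin_part assms)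
  show "GDERIV (fin_part f) x :> gradient f x" if "x \<in> edom f" for x
    using smooth that by (intro GDERIV_gradient) (simp add: ell_smooth_def)
qed (use smooth in \<open>simp_all add: ell_smooth_def \<open>open (edom f)\<close>\<close>)

section \<open>Invariant of the iterates and the complexity bound\<close>

lemma closest_point_dist_le:
  assumes "convex S" "closed S" "x \<in> S"
  shows "norm (closest_point S v - x) \<le> norm (v - x)"
  using closest_point_lipschitz[of S v x] assms by (auto simp: closest_point_self dist_norm)

lemma agd_invariant:
  fixes f :: "real^'d \<Rightarrow> ereal"
  assumes smooth: "gen_smooth (edom f) (fin_part f) (gradient f) H ell"
    and params: "agd_parameters ell \<Gamma>0 Rbar"
    and x0: "x0 \<in> edom f" and xs: "xs \<in> edom f"
    and min: "\<And>x. x \<in> edom f \<Longrightarrow> fin_part f xs \<le> fin_part f x"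
    and R: "norm (x0 - xs) \<le> Rbar"
    and \<Gamma>0: "2 * (fin_part f x0 - fin_part f xs) \<le> \<Gamma>0 * (norm (x0 - xs))\<^sup>2"
  shows "fst (agd f ell \<Gamma>0 Rbar x0 k) \<in> edom f \<and>
    fin_part f (fst (agd f ell \<Gamma>0 Rbar x0 k)) - fin_part f xs
      + agd_Gamma ell \<Gamma>0 Rbar k / 2 * (norm (snd (agd f ell \<Gamma>0 Rbar x0 k) - xs))\<^sup>2
      \<le> agd_Gamma ell \<Gamma>0 Rbar k * (norm (x0 - xs))\<^sup>2"
proof -
  interpret gen_smooth "edom f" "fin_part f" "gradient f" H ell by (rule smooth)
  interpret P: agd_parameters ell \<Gamma>0 Rbar by (rule params)
  let ?R = "norm (x0 - xs)"
  have grad0: "gradient f xs = 0"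
  proof -
    have "(\<lambda>h. h \<bullet> gradient f xs) = (\<lambda>h. 0)"
      using differential_zero_maxmin[OF xs open_X F_deriv[OF xs, unfolded gderiv_def]] min by blast
    then show ?thesis by (metis inner_eq_zero_iff)
  qed
  show ?thesis
  proof (induction k)
    case 0
    \<comment> \<open>Half of the right-hand side covers the function gap, by the choice of
      \<open>\<Gamma>0\<close>; the other half is the distance term, since \<open>u\<close> starts
      at \<open>x0\<close>.\<close>
    show ?case using x0 \<Gamma>0 by simp
  next
    case (Suc k)
    define y u where "y = fst (agd f ell \<Gamma>0 Rbar x0 k)" and "u = snd (agd f ell \<Gamma>0 Rbar x0 k)"
    define \<Gamma> \<gamma> \<alpha> where "\<Gamma> = P.Gam k" and "\<gamma> = P.gamma k" and "\<alpha> = P.alpha k"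
    define y' where "y' = (1 / (1 + \<alpha>)) *\<^sub>R y + (\<alpha> / (1 + \<alpha>)) *\<^sub>R u - (\<gamma> / (1 + \<alpha>)) *\<^sub>R gradient f y"
    define v where "v = u - (\<alpha> / \<Gamma>) *\<^sub>R gradient f y'"
    define u' where "u' = closest_point (closure (edom f)) v"
    define M where "M = psi_inv ell (\<Gamma> * Rbar\<^sup>2)"
    have next_iterate: "agd f ell \<Gamma>0 Rbar x0 (Suc k) = (y', u')"
      by (simp add: Let_def case_prod_beta y'_def u'_def v_def y_def u_def \<Gamma>_def \<gamma>_def \<alpha>_def)
    have \<Gamma>: "\<Gamma> > 0" and \<alpha>: "\<alpha> \<ge> 0"
      by (auto simp: \<Gamma>_def \<alpha>_def P.Gam_pos P.alpha_nonneg)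
    then have M: "M > 0" "psi ell M = \<Gamma> * Rbar\<^sup>2"
      using P.Rbar by (auto simp: M_def P.psi_inv_pos P.psi_inv)
    have y: "y \<in> edom f"
      and V: "fin_part f y - fin_part f xs + \<Gamma> / 2 * (norm (u - xs))\<^sup>2 \<le> \<Gamma> * ?R\<^sup>2"
      using Suc by (auto simp: y_def u_def \<Gamma>_def)
    have "\<Gamma> * ?R\<^sup>2 \<le> psi ell M"
      using \<Gamma> R unfolding M by (intro mult_left_mono power_mono) auto
    with V have "fin_part f y - fin_part f xs + \<Gamma> / 2 * (norm (u - xs))\<^sup>2 \<le> psi ell M" by simp
    note step = accelerated_step[OF y xs grad0 min P.psi_mono \<Gamma> M(1) this _ _ y'_def]
    have \<gamma>\<alpha>: "\<gamma> = 1 / ell (4 * M)" "\<alpha> = sqrt (\<gamma> * \<Gamma>)"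
      by (simp_all add: \<gamma>_def M_def \<Gamma>_def step_gamma_def \<alpha>_def step_alpha_def)
    \<comment> \<open>Projecting onto a convex set containing \<open>xs\<close> brings no point
      farther from \<open>xs\<close>, so the decrease for the unprojected point \<open>v\<close>
      carries over.\<close>
    have "norm (u' - xs) \<le> norm (v - xs)"
      unfolding u'_def using xs closure_subset[of "edom f"] convex_X
      by (intro closest_point_dist_le convex_closure) auto
    then have "\<Gamma> / 2 * (norm (u' - xs))\<^sup>2 \<le> \<Gamma> / 2 * (norm (v - xs))\<^sup>2"
      using \<Gamma> by (intro mult_left_mono power_mono) auto
    then have "(1 + \<alpha>) * (fin_part f y' - fin_part f xs) + \<Gamma> / 2 * (norm (u' - xs))\<^sup>2 \<le> \<Gamma> * ?R\<^sup>2"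
      using step(2)[OF _ \<gamma>\<alpha>] V by (simp add: v_def)
    \<comment> \<open>Both sides thus carry the factor \<open>1 + \<alpha>\<close>; cancelling it
      restores the invariant with the next \<open>Gam\<close>.\<close>
    moreover have "\<Gamma> = (1 + \<alpha>) * P.Gam (Suc k)"
      using \<alpha> by (simp add: \<Gamma>_def \<alpha>_def)
    ultimately have "(1 + \<alpha>) * (fin_part f y' - fin_part f xs + P.Gam (Suc k) / 2 * (norm (u' - xs))\<^sup>2)
        \<le> (1 + \<alpha>) * (P.Gam (Suc k) * ?R\<^sup>2)"
      by (simp add: distrib_left mult.assoc del: agd_Gamma.simps)
    then have "fin_part f y' - fin_part f xs + P.Gam (Suc k) / 2 * (norm (u' - xs))\<^sup>2
        \<le> P.Gam (Suc k) * ?R\<^sup>2"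
      using \<alpha> by (simp del: agd_Gamma.simps)
    with step(1)[OF _ \<gamma>\<alpha>] show ?case
      unfolding next_iterate by simp
  qed
qed

theorem theorem4p2:
  fixes f :: "real^'d \<Rightarrow> ereal" and ell :: "real \<Rightarrow> real"
    and x0 xs :: "real^'d" and R Rbar \<Gamma>0 \<epsilon> :: real
  assumes "\<forall>x. f x \<noteq> -\<infinity>"
    and "edom f \<noteq> {}" and "open (edom f)" and "convex (edom f)"
    and "convex_ereal_fun f" and "ell_smooth ell f"
    and "\<forall>x. f xs \<le> f x"
    and "x0 \<in> edom f" and "x0 \<noteq> xs" and "R = norm (x0 - xs)"
    and "strict_mono_on {0..} (psi ell)" and "filterlim (psi ell) at_top at_top"
    and "\<Gamma>0 > 0"
    and "ereal \<Gamma>0 \<ge> 2 * (f x0 - f xs) / ereal ((norm (x0 - xs))\<^sup>2)"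
    and "Rbar \<ge> R" and "\<epsilon> > 0"
  shows "agd_oracle_complexity f ell \<Gamma>0 Rbar x0 \<epsilon> \<le>
    enat (nat \<lceil>5 * sqrt (ell 0) * R / sqrt \<epsilon>
      + max (2 + log (3/2) (\<Gamma>0 / (4 * ell 0))) 0
      + real (k_init ell \<Gamma>0 Rbar)\<rceil>)"
proof -
  define B where "B = 5 * sqrt (ell 0) * R / sqrt \<epsilon>
      + max (2 + log (3/2) (\<Gamma>0 / (4 * ell 0))) 0 + real (k_init ell \<Gamma>0 Rbar)"
  define N where "N = nat \<lceil>B\<rceil>"
  note fin = assms(1)
  interpret gen_smooth "edom f" "fin_part f" "gradient f" "\<lambda>x v. hessian f x *v v" ell
    by (intro gen_smooth_fin_part assms)
  have R: "R > 0" using assms by simp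
  interpret P: agd_parameters ell \<Gamma>0 Rbar
  proof
    show "continuous_on {0..} ell"
      using assms(6) local_lipschitz_continuous_on[of UNIV "{0..}" "\<lambda>_. ell" "0::real"]
      by (simp add: ell_smooth_def)
    show "Rbar > 0" using R assms(15) by linarith
  qed (use assms(11-13) ell_mono ell_pos in auto)
  have xs: "xs \<in> edom f"
    using assms(7,8) le_less_trans by (auto simp: edom_def)
  have eq: "f x = ereal (fin_part f x)" if "x \<in> edom f" for x
    using ereal_fin_part[of f x] fin that by simp
  have min: "fin_part f xs \<le> fin_part f x" if "x \<in> edom f" for x
    using assms(7) eq[OF xs] eq[OF that] by (metis ereal_less_eq(3))
  have "(2 :: ereal) * ereal r = ereal (2 * r)" for r
    by (metis numeral_eq_ereal times_ereal.simps(1))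
  then have "2 * (fin_part f x0 - fin_part f xs) / R\<^sup>2 \<le> \<Gamma>0"
    using assms(14) R unfolding eq[OF xs] eq[OF assms(8)] assms(10)[symmetric] by simp
  then have "2 * (fin_part f x0 - fin_part f xs) \<le> \<Gamma>0 * R\<^sup>2"
    using R by (simp add: divide_le_eq)
  note inv = agd_invariant[OF gen_smooth_axioms P.agd_parameters_axioms assms(8) xs min
      assms(15)[unfolded assms(10)] this[unfolded assms(10)], folded assms(10) agd_y_def]
  have gap: "agd_y f ell \<Gamma>0 Rbar x0 k \<in> edom f"
    "fin_part f (agd_y f ell \<Gamma>0 Rbar x0 k) - fin_part f xs \<le> P.Gam k * R\<^sup>2" for k
  proof -
    have "0 \<le> P.Gam k / 2 * (norm (snd (agd f ell \<Gamma>0 Rbar x0 k) - xs))\<^sup>2"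
      using P.Gam_pos[of k] by simp
    then show "agd_y f ell \<Gamma>0 Rbar x0 k \<in> edom f"
      "fin_part f (agd_y f ell \<Gamma>0 Rbar x0 k) - fin_part f xs \<le> P.Gam k * R\<^sup>2"
      using inv[of k] by linarith+
  qed
  have "P.Gam N * R\<^sup>2 \<le> \<epsilon>"
  proof (rule P.Gam_rate)
    show "5 * sqrt (ell 0) * R / sqrt \<epsilon> + max (2 + log (3/2) (\<Gamma>0 / (4 * ell 0))) 0
        + real (k_init ell \<Gamma>0 Rbar) \<le> real N"
      unfolding B_def[symmetric] N_def by (rule real_nat_ceiling_ge)
  qed (use R assms in auto)
  with gap(2)[of N] have "fin_part f (agd_y f ell \<Gamma>0 Rbar x0 N) - fin_part f xs \<le> \<epsilon>" by simp
  moreover have "(INF z. f z) = f xs"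
    using assms(7) by (intro antisym INF_greatest INF_lower) auto
  ultimately have "eps_solution f \<epsilon> (agd_y f ell \<Gamma>0 Rbar x0 N)"
    using gap(1)[of N] xs by (simp add: eps_solution_def eq)
  \<comment> \<open>All iterates lie in the domain, so \<open>N\<close> belongs to the set whose
    infimum is the complexity.\<close>
  then show ?thesis
    unfolding agd_oracle_complexity_def B_def[symmetric] N_def[symmetric]
    using gap(1) by (intro Inf_lower) blast
qed

end
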